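(* Let $m,n\ge 1$, let $A\in\mathbb{R}^{m\times n}$ have rows $a_1^T,\dots,a_m^T$ with $\|a_i\|^2=1$ for all $i$, let $b\in\mathbb{R}^m$, and let $\rho>0$. Consider the randomized augmented Kaczmarz (RAK) iteration with penalty parameter $\rho$ started at $x_0\in\mathbb{R}^n$, $z_0\in\mathbb{R}$. (LS) Suppose the linear system $Ax=b$ is consistent, let $x^*=\arg\min_{Ax=b}\|x_0-x\|^2=x_0-A^{\dagger}(Ax_0-b)$, and let $$\mathcal{V}(x_k,z_k)=\|x_k-x^*\|^2+\frac1\rho|z_k|^2 .$$ Then the sequence generated by the RAK iteration for the LS problem converges, in the sense that $\mathbb{E}[\|x_k-x^*\|^2]\to 0$ as $k\to\infty$, and for every $k\ge 0$ $$\mathbb{E}\left[\mathcal{V}(x_{k+1},z_{k+1})\right]\le\left(1-\frac{\rho}{1+\rho}\,\frac{\lambda_{\min}(A^TA)}{m}\right)^{k+1}\mathbb{E}\left[\mathcal{V}(x_0,z_0)\right].$$ (LF) Suppose the feasible region $\mathcal{X}=\{x\in\mathbb{R}^n: Ax\le b\}$ is nonempty, let $L>0$ be a Hoffman constant for it, and let $$\mathcal{U}(x_k,z_k)=d(x_k,\mathcal{X})^2+\frac1\rho|z_k|^2 .$$ Then the sequence generated by the RAK iteration for the LF problem converges, in the sense that $\mathbb{E}[d(x_k,\mathcal{X})^2]\to 0$ as $k\to\infty$, and for every $k\ge 0$ $$\mathbb{E}\left[\mathcal{U}(x_{k+1},z_{k+1})\right]\le\left(1-\frac{\rho}{1+\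rho}\,\frac{1}{mL^2}\right)^{k+1}\mathbb{E}\left[\mathcal{U}(x_0,z_0)\right].$$
   Context: Notation: $\|\cdot\|$ is the Euclidean norm; $t^+=\max\{t,0\}$, applied componentwise to vectors; $\lambda_{\min}(A^TA)$ is the smallest eigenvalue of $A^TA$; $A^\dagger$ is the Moore–Penrose pseudoinverse; vector inequalities are componentwise. Problems: LS asks for $x$ with $Ax=b$; LF asks for $x$ with $Ax\le b$. For LF, $d(x,\mathcal{X})=\min_{y\in\mathcal{X}}\|x-y\|=\|x-\mathcal{P}(x)\|$, where $\mathcal{P}$ is the Euclidean projection onto $\mathcal{X}$. Hoffman constant: a constant $L>0$ such that $d(x,\mathcal{X})^2\le L^2\|(Ax-b)^+\|^2$ for all $x\in\mathbb{R}^n$ (such a constant exists by Hoffman's theorem). RAK iteration with fixed penalty parameter $\rho>0$: choose initial points $x_0\in\mathbb{R}^n$ and $z_0\in\mathbb{R}$. For $k=0,1,2,\dots$, select an index $i\in\{1,\dots,m\}$ at random, independently of the previous choices, with probability $p_i=\|a_i\|^2/\|A\|_F^2$ (which equals $1/m$ since all rows have unit norm), and set $$z_{k+1}=\begin{cases}\dfrac{(a_i^Tx_k-b_i)+\frac1\rho z_k}{\frac1\rho+\|a_i\|^2} & \text{(LS)},\\[2ex] \dfrac{\left[(a_i^Tx_k-b_i)+\frac1\rho z_k\right]^+}{\frac1\rho+\|a_i\|^2} & \text{(LF)},\end{cases}\qquad x_{k+1}=x_k-z_{k+1}a_i .$$ $\mathbb{E}$ denotes expectation over all random index choices. *)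

theory Defs
  imports "HOL-Probability.Probability"
begin

text \<open>
  The dimensions are index types: a matrix with \<open>m = CARD('m)\<close> rows and \<open>n = CARD('n)\<close> columns
  has type \<open>real^'n^'m\<close>, and both are automatically at least 1. On \<open>real^'m\<close> the
  library order \<open>\<le>\<close> is componentwise.
\<close>

definition eigenvalue :: "real^'n^'n \<Rightarrow> real \<Rightarrow> bool" where
  "eigenvalue M c \<longleftrightarrow> (\<exists>v. v \<noteq> 0 \<and> M *v v = c *\<^sub>R v)"

text \<open>Only meaningful when a smallest real eigenvalue exists, as it does for symmetric matrices.\<close>

definition lambda_min :: "real^'n^'n \<Rightarrow> real" where
  "lambda_min M = (LEAST c. eigenvalue M c)"

text \<open>The Moore--Penrose pseudoinverse, as the unique matrix satisfying the four Penrose equations.\<close>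

definition is_pseudoinverse :: "real^'n^'m \<Rightarrow> real^'m^'n \<Rightarrow> bool" where
  "is_pseudoinverse A B \<longleftrightarrow>
     A ** B ** A = A \<and> B ** A ** B = B \<and>
     transpose (A ** B) = A ** B \<and> transpose (B ** A) = B ** A"

definition pseudoinverse :: "real^'n^'m \<Rightarrow> real^'m^'n" where
  "pseudoinverse A = (THE B. is_pseudoinverse A B)"

definition pos_part :: "real^'m \<Rightarrow> real^'m" where
  "pos_part v = (\<chi> i. max (v $ i) 0)"

definition feasible_region :: "real^'n^'m \<Rightarrow> real^'m \<Rightarrow> (real^'n) set" where
  "feasible_region A b = {x. A *v x \<le> b}"

text \<open>
  The distance to the feasible region is the library's \<open>infdist\<close>: the region is closed, so
  the infimum is attained whenever the region is nonempty.
\<close>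

definition hoffman_constant :: "real^'n^'m \<Rightarrow> real^'m \<Rightarrow> real \<Rightarrow> bool" where
  "hoffman_constant A b L \<longleftrightarrow> L > 0 \<and>
     (\<forall>x. (infdist x (feasible_region A b))\<^sup>2 \<le> L\<^sup>2 * (norm (pos_part (A *v x - b)))\<^sup>2)"

text \<open>
  The iterations produce the pair \<open>(x\<^sub>k, z\<^sub>k)\<close> along a given sequence \<open>i\<close> of
  selected indices; \<open>i k\<close> is the index used in the step from \<open>k\<close> to \<open>k + 1\<close>.
\<close>

primrec rak_LS ::
  "real^'n^'m \<Rightarrow> real^'m \<Rightarrow> real \<Rightarrow> real^'n \<Rightarrow> real \<Rightarrow> (nat \<Rightarrow> 'm) \<Rightarrow> nat \<Rightarrow> (real^'n) \<times> real"
where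
  "rak_LS A b \<rho> x0 z0 i 0 = (x0, z0)"
| "rak_LS A b \<rho> x0 z0 i (Suc k) =
     (let (x, z) = rak_LS A b \<rho> x0 z0 i k;
          a = row (i k) A;
          z' = ((a \<bullet> x - b $ i k) + 1 / \<rho> * z) / (1 / \<rho> + (norm a)\<^sup>2)
      in (x - z' *\<^sub>R a, z'))"

primrec rak_LF ::
  "real^'n^'m \<Rightarrow> real^'m \<Rightarrow> real \<Rightarrow> real^'n \<Rightarrow> real \<Rightarrow> (nat \<Rightarrow> 'm) \<Rightarrow> nat \<Rightarrow> (real^'n) \<times> real"
where
  "rak_LF A b \<rho> x0 z0 i 0 = (x0, z0)"
| "rak_LF A b \<rho> x0 z0 i (Suc k) =
     (let (x, z) = rak_LF A b \<rho> x0 z0 i k;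
          a = row (i k) A;
          z' = max ((a \<bullet> x - b $ i k) + 1 / \<rho> * z) 0 / (1 / \<rho> + (norm a)\<^sup>2)
      in (x - z' *\<^sub>R a, z'))"

definition lyapunov_LS :: "real \<Rightarrow> real^'n \<Rightarrow> (real^'n) \<times> real \<Rightarrow> real" where
  "lyapunov_LS \<rho> xs = (\<lambda>(x, z). (norm (x - xs))\<^sup>2 + 1 / \<rho> * \<bar>z\<bar>\<^sup>2)"

definition lyapunov_LF :: "real^'n^'m \<Rightarrow> real^'m \<Rightarrow> real \<Rightarrow> (real^'n) \<times> real \<Rightarrow> real" where
  "lyapunov_LF A b \<rho> = (\<lambda>(x, z). (infdist x (feasible_region A b))\<^sup>2 + 1 / \<rho> * \<bar>z\<bar>\<^sup>2)"

text \<open>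
  Independent random indices on a probability space, index \<open>i\<close> being selected with probability
  \<open>\<parallel>a\<^sub>i\<parallel>\<^sup>2 / \<parallel>A\<parallel>\<^sub>F\<^sup>2\<close>. The library norm on \<open>real^'n^'m\<close> is the Euclidean norm of the
  vector of row norms, that is, the Frobenius norm.
\<close>

definition rak_sampling :: "real^'n^'m \<Rightarrow> 'w measure \<Rightarrow> (nat \<Rightarrow> 'w \<Rightarrow> 'm) \<Rightarrow> bool" where
  "rak_sampling A M I \<longleftrightarrow>
     prob_space M \<and>
     prob_space.indep_vars M (\<lambda>_. count_space UNIV) I UNIV \<and>
     (\<forall>k i. measure M {\<omega> \<in> space M. I k \<omega> = i} = (norm (row i A))\<^sup>2 / (norm A)\<^sup>2)"

end

theory Submission
  imports Defs
begin

text \<open>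
  Write \<open>\<kappa> = \<rho> / (1 + \<rho>)\<close>, let \<open>D\<close> be the squared distance of \<open>x\<close> to its target and
  \<open>Z = z\<^sup>2 / \<rho>\<close>. The update of \<open>z\<close> is an implicit (proximal) step, and for unit rows it turns one step
  with index \<open>i\<close> into the exact balance
  \<open>D' + Z' = D - \<kappa> r\<^sub>i\<^sup>2 + (1 - \<kappa>) Z\<close>, where \<open>r\<^sub>i\<close> is the residual of row \<open>i\<close> at \<open>x\<close>
  (\<open>dual_update_balance\<close>). For inequalities the clipping at zero and the replacement of the projection
  of the new point by that of the old one only cost inequalities in the right direction, and
  \<open>r\<^sub>i\<close> becomes its positive part (\<open>clipped_dual_update_balance\<close>).

  Averaging over the \<open>m\<close> equally likely rows replaces \<open>r\<^sub>i\<^sup>2\<close> by the squared norm of the residual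
  divided by \<open>m\<close>. An error bound, namely that this quantity is at least \<open>q D\<close>, then gives the
  contraction factor \<open>1 - \<kappa> q\<close> for \<open>D\<close>. The term \<open>Z\<close> contracts by \<open>1 - \<kappa>\<close>, so \<open>q \<le> 1\<close> makes the
  factor valid for both (\<open>average_contraction\<close>). Independence of the current index from the past
  lets these conditional estimates be iterated (\<open>expect_orbit_decay\<close>).

  The error bounds are as follows. For the decay rate of the linear system it is the variational
  characterisation of the smallest eigenvalue (\<open>lambda_min_gram_le\<close>), and for the system of
  inequalities it is the Hoffman bound; unit rows force \<open>q \<le> 1\<close> in both cases
  (\<open>lambda_min_gram_le_card\<close>, \<open>hoffman_card_ge_1\<close>). When the smallest eigenvalue is zero, its rate is
  void and convergence needs another argument: the error \<open>x\<^sub>k - x\<^sup>*\<close> starts in the row space of \<open>A\<close>,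
  because \<open>x\<^sup>*\<close> is the projection of \<open>x\<^sub>0\<close>, and each step moves along a row. On the row space
  \<open>A\<close> is bounded below by a positive constant (\<open>row_space_bounded_below\<close>), which gives some \<open>q > 0\<close>.
\<close>

section \<open>Random orbits driven by uniform indices\<close>

primrec orbit :: "('m \<Rightarrow> 's \<Rightarrow> 's) \<Rightarrow> 's \<Rightarrow> (nat \<Rightarrow> 'm) \<Rightarrow> nat \<Rightarrow> 's" where
  "orbit T s i 0 = s"
| "orbit T s i (Suc k) = T (i k) (orbit T s i k)"

lemma orbit_cong:
  assumes "\<And>j. j < k \<Longrightarrow> i j = i' j"
  shows "orbit T s i k = orbit T s i' k"
  using assms by (induction k) auto

lemma orbit_invariant:
  assumes "s \<in> S" "\<And>i s. s \<in> S \<Longrightarrow> T i s \<in> S"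
  shows "orbit T s i k \<in> S"
  using assms by (induction k) auto

locale uniform_indices = prob_space M for M :: "'w measure" +
  fixes I :: "nat \<Rightarrow> 'w \<Rightarrow> 'm::finite"
  assumes indep: "indep_vars (\<lambda>_. count_space UNIV) I UNIV"
    and uniform: "prob {\<omega> \<in> space M. I k \<omega> = i} = 1 / real CARD('m)"
begin

text \<open>
  The expectation after \<open>k\<close> steps is a functional of the observable \<open>f\<close>. This allows
  the conditional expectation given the first \<open>k\<close> indices to be expressed by a change of observable.
\<close>

definition expect_orbit :: "('m \<Rightarrow> 's \<Rightarrow> 's) \<Rightarrow> 's \<Rightarrow> nat \<Rightarrow> ('s \<Rightarrow> real) \<Rightarrow> real" where
  "expect_orbit T s k f = (\<integral>\<omega>. f (orbit T s (\<lambda>j. I j \<omega>) k) \<partial>M)"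

text \<open>
  There are only finitely many index prefixes of a given length, so every function of a prefix is
  measurable and bounded: neither \<open>T\<close> nor the observables need any regularity.
\<close>

lemma finite_prefix_measurable:
  "g \<in> borel_measurable (Pi\<^sub>M {..<k::nat} (\<lambda>_. count_space (UNIV :: 'm set)))"
  by (subst count_space_PiM_finite) (auto intro: countable_finite)

lemma orbit_restrict:
  "orbit T s (restrict (\<lambda>j. I j \<omega>) {..<k}) k = orbit T s (\<lambda>j. I j \<omega>) k"
  by (rule orbit_cong) simp

lemma measurable_index [measurable]: "I k \<in> measurable M (count_space UNIV)"
  using indep unfolding indep_vars_def by auto

lemma integrable_orbit:
  fixes f :: "'s \<Rightarrow> real"
  shows "integrable M (\<lambda>\<omega>. f (orbit T s (\<lambda>j. I j \<omega>) k))"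
proof -
  define Y where "Y = (\<lambda>\<omega>. restrict (\<lambda>j. I j \<omega>) {..<k})"
  define P where "P = (PiE {..<k} (\<lambda>_. UNIV) :: (nat \<Rightarrow> 'm) set)"
  define F where "F = (\<lambda>y. f (orbit T s y k))"
  have Y: "Y \<in> measurable M (Pi\<^sub>M {..<k} (\<lambda>_. count_space UNIV))"
    unfolding Y_def by measurable
  have meas: "(\<lambda>\<omega>. F (Y \<omega>)) \<in> borel_measurable M"
    by (rule measurable_compose[OF Y finite_prefix_measurable])
  have "finite P"
    unfolding P_def by (intro finite_PiE) auto
  \<comment> \<open>A crude uniform bound: one term of a finite sum over all prefixes.\<close>
  have "norm (F (Y \<omega>)) \<le> (\<Sum>y\<in>P. norm (F y))" for \<omega>
    by (rule member_le_sum[where f = "\<lambda>y. norm (F y)"]) (use \<open>finite P\<close> in \<open>auto simp: P_def Y_def\<close>)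
  then have "integrable M (\<lambda>\<omega>. F (Y \<omega>))"
    by (intro integrable_const_bound[OF _ meas]) auto
  then show ?thesis
    by (simp add: F_def Y_def orbit_restrict)
qed

lemma expect_orbit_mono:
  assumes "s \<in> S" "\<And>i s. s \<in> S \<Longrightarrow> T i s \<in> S" "\<And>s. s \<in> S \<Longrightarrow> f s \<le> g s"
  shows "expect_orbit T s k f \<le> expect_orbit T s k g"
  unfolding expect_orbit_def
  by (intro integral_mono integrable_orbit assms(3) orbit_invariant assms(1,2))

lemma expect_orbit_0: "expect_orbit T s 0 f = f s"
  by (simp add: expect_orbit_def prob_space)

lemma expect_orbit_cmult: "expect_orbit T s k (\<lambda>s. c * f s) = c * expect_orbit T s k f"
  by (simp add: expect_orbit_def)

text \<open>
  The Markov property. The state after \<open>k\<close> steps depends on the indices before \<open>k\<close> only and is hence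
  independent of the index used next. Splitting by the value of that index turns the
  expectation into a sum of products of independent factors.
\<close>

lemma expect_orbit_Suc:
  "expect_orbit T s (Suc k) f
     = expect_orbit T s k (\<lambda>s. (\<Sum>i\<in>UNIV. f (T i s)) / real CARD('m))"
proof -
  let ?X = "\<lambda>\<omega>. orbit T s (\<lambda>j. I j \<omega>) k"
  let ?A = "\<lambda>i \<omega>. indicator {i} (I k \<omega>) :: real"
  let ?B = "\<lambda>i \<omega>. f (T i (?X \<omega>))"
  have "indep_var (Pi\<^sub>M {..<k} (\<lambda>_. count_space UNIV)) (\<lambda>\<omega>. restrict (\<lambda>j. I j \<omega>) {..<k})
     (Pi\<^sub>M {k} (\<lambda>_. count_space UNIV)) (\<lambda>\<omega>. restrict (\<lambda>j. I j \<omega>) {k})"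
    by (rule indep_var_restrict[OF indep]) auto
  then have "indep_var borel
     ((\<lambda>y. f (T i (orbit T s y k))) \<circ> (\<lambda>\<omega>. restrict (\<lambda>j. I j \<omega>) {..<k}))
     borel ((\<lambda>y. indicator {i} (y k) :: real) \<circ> (\<lambda>\<omega>. restrict (\<lambda>j. I j \<omega>) {k}))" for i
    by (rule indep_var_compose) (rule finite_prefix_measurable, measurable)
  then have ind: "indep_var borel (?B i) borel (?A i)" for i
    by (simp add: o_def orbit_restrict)
  have intB: "integrable M (?B i)" for i
    by (rule integrable_orbit)
  have intA: "integrable M (?A i)" for i
    by (rule integrable_const_bound[where B = 1]) auto
  have EA: "(\<integral>\<omega>. ?A i \<omega> \<partial>M) = 1 / real CARD('m)" for i
  proof -
    have "(\<integral>\<omega>. ?A i \<omega> \<partial>M) = (\<integral>\<omega>. indicator {\<omega> \<in> space M. I k \<omega> = i} \<omega> \<partial>M)"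
      by (rule Bochner_Integration.integral_cong) (auto simp: indicator_def)
    also have "\<dots> = prob {\<omega> \<in> space M. I k \<omega> = i}"
      by (simp add: Int_absorb2)
    finally show ?thesis by (simp add: uniform)
  qed
  have "expect_orbit T s (Suc k) f = (\<integral>\<omega>. (\<Sum>i\<in>UNIV. ?B i \<omega> * ?A i \<omega>) \<partial>M)"
    unfolding expect_orbit_def
    by (rule Bochner_Integration.integral_cong) (auto simp: indicator_def if_distrib cong: if_cong)
  also have "\<dots> = (\<Sum>i\<in>UNIV. (\<integral>\<omega>. ?B i \<omega> * ?A i \<omega> \<partial>M))"
    by (intro Bochner_Integration.integral_sum indep_var_integrable ind intB intA)
  also have "\<dots> = (\<Sum>i\<in>UNIV. (\<integral>\<omega>. ?B i \<omega> \<partial>M) * (1 / real CARD('m)))"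
    by (simp only: indep_var_lebesgue_integral[OF ind intB intA] EA)
  also have "\<dots> = expect_orbit T s k (\<lambda>s. (\<Sum>i\<in>UNIV. f (T i s)) / real CARD('m))"
    by (simp add: expect_orbit_def Bochner_Integration.integral_sum[OF intB] flip: sum_divide_distrib)
  finally show ?thesis .
qed

text \<open>
  The invariant set \<open>S\<close> is what makes the lemma usable when \<open>V\<close> contracts on the reachable states
  only, as it does for rank-deficient systems.
\<close>

lemma expect_orbit_decay:
  assumes S: "s \<in> S" "\<And>i s. s \<in> S \<Longrightarrow> T i s \<in> S"
    and V: "\<And>s. s \<in> S \<Longrightarrow> (\<Sum>i\<in>UNIV. V (T i s)) / real CARD('m) \<le> \<theta> * V s"
    and \<theta>: "0 \<le> \<theta>"
  shows "expect_orbit T s k V \<le> \<theta> ^ k * V s"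
proof (induction k)
  case 0
  show ?case by (simp add: expect_orbit_0)
next
  case (Suc k)
  have "expect_orbit T s (Suc k) V \<le> expect_orbit T s k (\<lambda>s. \<theta> * V s)"
    unfolding expect_orbit_Suc by (rule expect_orbit_mono[OF S V])
  also have "\<dots> \<le> \<theta> * (\<theta> ^ k * V s)"
    unfolding expect_orbit_cmult by (rule mult_left_mono[OF Suc \<theta>])
  finally show ?case by (simp add: mult.assoc)
qed

lemma expect_orbit_tendsto_0:
  assumes S: "s \<in> S" "\<And>i s. s \<in> S \<Longrightarrow> T i s \<in> S"
    and V: "\<And>s. s \<in> S \<Longrightarrow> (\<Sum>i\<in>UNIV. V (T i s)) / real CARD('m) \<le> \<theta> * V s"
    and \<theta>: "0 \<le> \<theta>" "\<theta> < 1"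
    and f: "\<And>s. 0 \<le> f s" "\<And>s. f s \<le> V s"
  shows "(\<lambda>k. expect_orbit T s k f) \<longlonglongrightarrow> 0"
proof (rule tendsto_sandwich[where f = "\<lambda>_. 0" and h = "\<lambda>k. \<theta> ^ k * V s"])
  show "\<forall>\<^sub>F k in sequentially. 0 \<le> expect_orbit T s k f"
    by (simp add: expect_orbit_def f(1))
  have "expect_orbit T s k f \<le> \<theta> ^ k * V s" for k
  proof -
    have "expect_orbit T s k f \<le> expect_orbit T s k V"
      by (rule expect_orbit_mono[OF S f(2)])
    also have "\<dots> \<le> \<theta> ^ k * V s"
      by (rule expect_orbit_decay[where S = S and T = T and V = V, OF S V \<theta>(1)])
    finally show ?thesis .
  qed
  then show "\<forall>\<^sub>F k in sequentially. expect_orbit T s k f \<le> \<theta> ^ k * V s"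
    by simp
  show "(\<lambda>k. \<theta> ^ k * V s) \<longlonglongrightarrow> 0"
    using tendsto_mult_right[OF LIMSEQ_realpow_zero[OF \<theta>], of "V s"] by simp
qed simp

end

section \<open>Linear algebra\<close>

text \<open>
  Products with the transpose stay in the form \<open>transpose A *v x\<close>, so that associativity of the
  matrix product applies to them.
\<close>

declare transpose_matrix_vector [simp del]

lemma inner_matrix_transpose: "(A *v x) \<bullet> y = x \<bullet> (transpose A *v y)"
  for A :: "real^'n^'m"
  by (metis dot_lmul_matrix inner_commute transpose_matrix_vector)

lemma norm_sq_sum: "(norm v)\<^sup>2 = (\<Sum>i\<in>UNIV. (v $ i)\<^sup>2)"
  for v :: "real^'m"
  unfolding power2_norm_eq_inner by (simp add: inner_vec_def power2_eq_square)

lemma matrix_vector_component_row: "(A *v x) $ i = row i A \<bullet> x"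
  for A :: "real^'n^'m"
  by (simp add: matrix_vector_mul_component row_def)

lemma norm_matrix_vector_le_unit_rows:
  fixes A :: "real^'n^'m"
  assumes "\<forall>i. (norm (row i A))\<^sup>2 = 1"
  shows "(norm (A *v x))\<^sup>2 \<le> real CARD('m) * (norm x)\<^sup>2"
proof -
  have "(row i A \<bullet> x)\<^sup>2 \<le> (norm x)\<^sup>2" for i
    using Cauchy_Schwarz_ineq[of "row i A" x] assms by (simp add: power2_norm_eq_inner)
  then have "(\<Sum>i\<in>UNIV. (row i A \<bullet> x)\<^sup>2) \<le> (\<Sum>i\<in>(UNIV::'m set). (norm x)\<^sup>2)"
    by (intro sum_mono) auto
  then show ?thesis
    by (simp add: norm_sq_sum[of "A *v x"] matrix_vector_component_row)
qed

abbreviation row_space :: "real^'n^'m \<Rightarrow> (real^'n) set" where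
  "row_space A \<equiv> range ((*v) (transpose A))"

lemma subspace_row_space: "subspace (row_space A)"
  by (intro linear_subspace_image matrix_vector_mul_linear subspace_UNIV)

lemma row_in_row_space: "row i A \<in> row_space A"
  for A :: "real^'n^'m"
proof -
  have "row i A = transpose A *v axis i 1"
    by (simp add: matrix_vector_mul_component vec_eq_iff row_def transpose_def inner_axis)
  then show ?thesis by blast
qed

lemma row_space_orthogonal_kernel:
  fixes A :: "real^'n^'m"
  assumes "x \<in> row_space A" "A *v y = 0"
  shows "x \<bullet> y = 0"
  using assms inner_matrix_transpose[of A y] by (auto simp: inner_commute)

lemma row_space_kernel_trivial:
  fixes A :: "real^'n^'m"
  assumes "x \<in> row_space A" "A *v x = 0"
  shows "x = 0"
  using row_space_orthogonal_kernel[OF assms] by simp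

text \<open>
  On the row space \<open>A\<close> is injective, and an injective linear map on a finite-dimensional space is
  bounded below. The best constant is the square of the smallest nonzero singular value.
\<close>

lemma row_space_bounded_below:
  fixes A :: "real^'n^'m"
  obtains c where "c > 0" "\<And>x. x \<in> row_space A \<Longrightarrow> c * (norm x)\<^sup>2 \<le> (norm (A *v x))\<^sup>2"
proof -
  obtain e where e: "e > 0" "\<forall>x\<in>row_space A. e * norm x \<le> norm (A *v x)"
    using injective_imp_isometric[of "row_space A" "(*v) A"] row_space_kernel_trivial[of _ A]
    by (auto simp: closed_subspace subspace_row_space)
  have "e\<^sup>2 * (norm x)\<^sup>2 \<le> (norm (A *v x))\<^sup>2" if "x \<in> row_space A" for x
    using power_mono[of "e * norm x" "norm (A *v x)" 2] e that by (simp add: power_mult_distrib)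
  then show thesis
    using that[of "e\<^sup>2"] e(1) by simp
qed

lemma gram_norm: "(norm (A *v x))\<^sup>2 = x \<bullet> ((transpose A ** A) *v x)"
  for A :: "real^'n^'m"
  by (simp add: power2_norm_eq_inner inner_matrix_transpose matrix_vector_mul_assoc)

text \<open>
  The minimum \<open>\<mu>\<close> of the Rayleigh quotient is attained on the compact unit sphere, and a minimiser is an
  eigenvector. Every eigenvalue is the Rayleigh quotient of its eigenvector, so \<open>\<mu>\<close> is the
  least eigenvalue; in particular the least eigenvalue exists.
\<close>

lemma lambda_min_gram_le:
  fixes A :: "real^'n^'m"
  shows "lambda_min (transpose A ** A) * (norm x)\<^sup>2 \<le> (norm (A *v x))\<^sup>2"
proof -
  let ?G = "transpose A ** A"
  let ?S = "sphere (0 :: real^'n) 1"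
  have "?S \<noteq> {}" "compact ?S" by auto
  moreover have "continuous_on ?S (\<lambda>v. (norm (A *v v))\<^sup>2)"
    by (intro continuous_intros linear_continuous_on matrix_vector_mul_bounded_linear)
  ultimately obtain v where v: "v \<in> ?S" "\<And>w. w \<in> ?S \<Longrightarrow> (norm (A *v v))\<^sup>2 \<le> (norm (A *v w))\<^sup>2"
    using continuous_attains_inf[of ?S "\<lambda>v. (norm (A *v v))\<^sup>2"] by blast
  define \<mu> where "\<mu> = (norm (A *v v))\<^sup>2"
  have low: "\<mu> * (norm w)\<^sup>2 \<le> (norm (A *v w))\<^sup>2" for w
  proof (cases "w = 0")
    case False
    have "A *v w = norm w *\<^sub>R (A *v ((1 / norm w) *\<^sub>R w))"
      using False by (simp add: matrix_vector_mult_scaleR)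
    moreover have "\<mu> \<le> (norm (A *v ((1 / norm w) *\<^sub>R w)))\<^sup>2"
      unfolding \<mu>_def by (rule v(2)) (use False in simp)
    ultimately show ?thesis
      using mult_right_mono[of \<mu> _ "(norm w)\<^sup>2"]
      by (simp add: power_mult_distrib mult.commute[of "(norm w)\<^sup>2"])
  qed simp
  \<comment> \<open>The gradient of the Rayleigh quotient at the minimiser, up to a factor; it has to vanish.\<close>
  define d where "d = ?G *v v - \<mu> *\<^sub>R v"
  define q where "q = (norm (A *v d))\<^sup>2 - \<mu> * (norm d)\<^sup>2"
  have "q \<ge> 0" using low[of d] by (simp add: q_def)
  have nv: "v \<bullet> v = 1" using v(1) by (simp add: norm_eq_1)
  have expand: "(norm (A *v (v + t *\<^sub>R d)))\<^sup>2 - \<mu> * (norm (v + t *\<^sub>R d))\<^sup>2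
      = 2 * t * (d \<bullet> d) + t\<^sup>2 * q" for t
  proof -
    have "(A *v d) \<bullet> (A *v v) - \<mu> * (d \<bullet> v) = d \<bullet> d"
      by (simp add: inner_matrix_transpose matrix_vector_mul_assoc d_def inner_diff_right)
    moreover have "(norm (A *v (v + t *\<^sub>R d)))\<^sup>2
      = \<mu> + 2 * t * ((A *v d) \<bullet> (A *v v)) + t\<^sup>2 * (norm (A *v d))\<^sup>2"
      unfolding matrix_vector_right_distrib matrix_vector_mult_scaleR \<mu>_def power2_norm_eq_inner
      by (simp add: inner_add_left inner_add_right inner_commute power2_eq_square algebra_simps)
    moreover have "(norm (v + t *\<^sub>R d))\<^sup>2 = 1 + 2 * t * (d \<bullet> v) + t\<^sup>2 * (norm d)\<^sup>2"
      unfolding power2_norm_eq_inner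
      by (simp add: inner_add_left inner_add_right inner_commute nv power2_eq_square algebra_simps)
    ultimately show ?thesis
      unfolding q_def by (simp add: algebra_simps)
  qed
  have "d \<bullet> d = 0"
  proof (rule ccontr)
    assume "d \<bullet> d \<noteq> 0"
    then have pos: "d \<bullet> d > 0" by simp
    \<comment> \<open>Moving against \<open>d\<close> by a small enough amount would undercut the minimum.\<close>
    define t where "t = - (d \<bullet> d) / (q + 1)"
    have "0 \<le> 2 * t * (d \<bullet> d) + t\<^sup>2 * q"
      using low[of "v + t *\<^sub>R d"] expand[of t] by simp
    also have "d \<bullet> d = - t * (q + 1)"
      using \<open>q \<ge> 0\<close> by (simp add: t_def)
    also have "2 * t * (- t * (q + 1)) + t\<^sup>2 * q = - (t\<^sup>2 * (q + 2))"
      by (simp add: power2_eq_square algebra_simps)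
    finally have "t\<^sup>2 * (q + 2) \<le> 0" by simp
    moreover have "t \<noteq> 0" using pos \<open>q \<ge> 0\<close> by (simp add: t_def)
    ultimately show False using \<open>q \<ge> 0\<close> by (simp add: mult_le_0_iff)
  qed
  then have "?G *v v = \<mu> *\<^sub>R v"
    unfolding inner_eq_zero_iff d_def by (rule eq_iff_diff_eq_0[THEN iffD2])
  moreover have "v \<noteq> 0" using nv by auto
  ultimately have eig: "eigenvalue ?G \<mu>"
    unfolding eigenvalue_def by (intro exI[of _ v] conjI)
  have "\<mu> \<le> c" if c: "eigenvalue ?G c" for c
  proof -
    obtain w where w: "w \<noteq> 0" "?G *v w = c *\<^sub>R w"
      using c unfolding eigenvalue_def by blast
    have "\<mu> * (norm w)\<^sup>2 \<le> c * (norm w)\<^sup>2"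
      using low[of w] unfolding gram_norm w(2) by (simp add: power2_norm_eq_inner)
    then show ?thesis using w(1) by simp
  qed
  with eig have "lambda_min ?G = \<mu>"
    unfolding lambda_min_def by (rule Least_equality)
  with low show ?thesis by simp
qed

text \<open>
  Compare both bounds for the norm of \<open>A *v v\<close> at any one unit vector \<open>v\<close>.
\<close>

lemma lambda_min_gram_le_card:
  fixes A :: "real^'n^'m"
  assumes "\<forall>i. (norm (row i A))\<^sup>2 = 1"
  shows "lambda_min (transpose A ** A) \<le> real CARD('m)"
proof -
  obtain v :: "real^'n" where "norm v = 1" using vector_choose_size[of 1] by auto
  with lambda_min_gram_le[of A v] norm_matrix_vector_le_unit_rows[OF assms, of v]
  show ?thesis by simp
qed

text \<open>
  The products \<open>A ** B\<close> and \<open>B ** A\<close> are the orthogonal projections onto the column space and the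
  row space of \<open>A\<close>, hence do not depend on \<open>B\<close>; and they determine \<open>B\<close>, because \<open>B = B ** A ** B\<close>.
\<close>

lemma is_pseudoinverse_unique:
  assumes "is_pseudoinverse A B" "is_pseudoinverse A C"
  shows "B = C"
proof -
  have *: "A ** B = A ** C" if "is_pseudoinverse A B" "is_pseudoinverse A C" for B C
  proof -
    have "A ** B = transpose ((A ** C) ** (A ** B))"
      using that by (simp add: is_pseudoinverse_def matrix_mul_assoc)
    also have "\<dots> = (A ** B) ** (A ** C)"
      using that by (simp only: is_pseudoinverse_def matrix_transpose_mul)
    also have "\<dots> = A ** C"
      using that by (simp add: is_pseudoinverse_def matrix_mul_assoc)
    finally show ?thesis .
  qed
  have "B ** A = transpose ((B ** A) ** (C ** A))"
    using assms by (simp add: is_pseudoinverse_def flip: matrix_mul_assoc)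
  also have "\<dots> = (C ** A) ** (B ** A)"
    using assms by (simp only: is_pseudoinverse_def matrix_transpose_mul)
  also have "\<dots> = C ** A"
    using assms by (simp add: is_pseudoinverse_def flip: matrix_mul_assoc)
  finally have BA: "B ** A = C ** A" .
  have "B = (B ** A) ** B" using assms by (simp add: is_pseudoinverse_def)
  also have "\<dots> = C ** (A ** B)" by (simp add: BA matrix_mul_assoc)
  also have "\<dots> = C" using *[OF assms] assms by (simp add: is_pseudoinverse_def matrix_mul_assoc)
  finally show ?thesis .
qed

text \<open>
  The Gram matrix has the same kernel as \<open>A\<close>, which meets the row space trivially. It is therefore
  an automorphism of the row space.
\<close>

lemma gram_image_row_space: "(*v) (transpose A ** A) ` row_space A = row_space A"
  and gram_inj_row_space: "inj_on ((*v) (transpose A ** A)) (row_space A)"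
  for A :: "real^'n^'m"
proof -
  let ?G = "transpose A ** A" and ?W = "row_space A"
  show inj: "inj_on ((*v) ?G) ?W"
  proof (rule inj_onI)
    fix x y assume xy: "x \<in> ?W" "y \<in> ?W" "?G *v x = ?G *v y"
    then have "?G *v (x - y) = 0" by (simp add: matrix_vector_mult_diff_distrib)
    then have "A *v (x - y) = 0" using gram_norm[of A "x - y"] by simp
    then have "x - y = 0"
      using xy by (intro row_space_kernel_trivial[of _ A]) (simp add: subspace_diff subspace_row_space)
    then show "x = y" by simp
  qed
  have sub: "(*v) ?G ` ?W \<subseteq> ?W"
    by (auto simp flip: matrix_vector_mul_assoc)
  have "dim ((*v) ?G ` ?W) = dim ?W"
    using inj by (intro dim_image_eq matrix_vector_mul_linear) (simp add: span_eq_iff[THEN iffD2, OF subspace_row_space])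
  then show "(*v) ?G ` ?W = ?W"
    using sub by (intro subspace_dim_equal linear_subspace_image matrix_vector_mul_linear subspace_row_space) auto
qed

text \<open>
  Let \<open>g\<close> invert the Gram matrix on the row space. Then \<open>g\<close> after the transpose of \<open>A\<close> solves the
  normal equations inside the row space, which is the least-squares solution of minimal norm and
  satisfies the four Penrose equations.
\<close>

lemma is_pseudoinverse_exists: "\<exists>B. is_pseudoinverse A B"
  for A :: "real^'n^'m"
proof -
  let ?G = "transpose A ** A" and ?W = "row_space A"
  obtain g where g: "range g \<subseteq> ?W" "linear g" "\<And>w. w \<in> ?W \<Longrightarrow> g (?G *v w) = w"
    using linear_exists_left_inverse_on[OF matrix_vector_mul_linear subspace_row_space gram_inj_row_space, of A]
    by blast
  define B where "B = matrix g ** transpose A"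
  have "matrix g *v y = g y" for y
    using fun_cong[OF matrix_vector_mul(2)[OF g(2)]] .
  then have B: "B *v y = g (transpose A *v y)" for y
    by (simp only: B_def flip: matrix_vector_mul_assoc)
  have BW: "B *v y \<in> ?W" for y
    unfolding B using g(1) by (rule subsetD) (rule rangeI)
  have Gg: "?G *v g w = w" if "w \<in> ?W" for w
  proof -
    from that have "w \<in> (*v) ?G ` ?W" by (simp only: gram_image_row_space)
    then obtain u where "u \<in> ?W" "w = ?G *v u" by (rule imageE)
    then show ?thesis by (simp only: g(3))
  qed
  have normal: "transpose A *v (A *v (B *v y)) = transpose A *v y" for y
    unfolding matrix_vector_mul_assoc[of "transpose A"] B by (rule Gg) (rule rangeI)
  have ABA: "A *v (B *v (A *v x)) = A *v x" for x
  proof -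
    have "?G *v (B *v (A *v x) - x) = 0"
      using normal[of "A *v x"] by (simp add: matrix_vector_mult_diff_distrib flip: matrix_vector_mul_assoc)
    then have "A *v (B *v (A *v x) - x) = 0"
      using gram_norm[of A "B *v (A *v x) - x"] by simp
    then show ?thesis by (simp add: matrix_vector_mult_diff_distrib)
  qed
  have BAw: "B *v (A *v w) = w" if "w \<in> ?W" for w
    unfolding B matrix_vector_mul_assoc[of "transpose A"] by (rule g(3)[OF that])
  \<comment> \<open>A map whose residuals are orthogonal to its range is an orthogonal projection.\<close>
  have selfadj: "transpose P = P" if "\<And>x y. (P *v x) \<bullet> (y - P *v y) = 0" for P :: "real^'k^'k"
  proof -
    have "(P *v x) \<bullet> y = x \<bullet> (P *v y)" for x y
      using that[of x y] that[of y x] by (simp add: inner_diff_right inner_commute)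
    then have "x \<bullet> (transpose P *v y) = x \<bullet> (P *v y)" for x y
      by (simp add: inner_matrix_transpose)
    then show ?thesis
      by (metis matrix_eq vector_eq_rdot inner_commute)
  qed
  have "transpose (A ** B) = A ** B"
  proof (rule selfadj)
    fix x y
    show "((A ** B) *v x) \<bullet> (y - (A ** B) *v y) = 0"
      using normal[of y]
      by (simp add: inner_matrix_transpose matrix_vector_mult_diff_distrib flip: matrix_vector_mul_assoc)
  qed
  moreover have "transpose (B ** A) = B ** A"
  proof (rule selfadj)
    fix x y
    show "((B ** A) *v x) \<bullet> (y - (B ** A) *v y) = 0"
      using ABA[of y] BW[of "A *v x"]
      by (intro row_space_orthogonal_kernel[of _ A])
         (simp_all add: matrix_vector_mult_diff_distrib flip: matrix_vector_mul_assoc)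
  qed
  moreover have "A ** B ** A = A" "B ** A ** B = B"
    using ABA BAw[OF BW] by (simp_all add: matrix_eq flip: matrix_vector_mul_assoc)
  ultimately show ?thesis unfolding is_pseudoinverse_def by blast
qed

lemma pseudoinverse: "is_pseudoinverse A (pseudoinverse A)"
  unfolding pseudoinverse_def
  by (rule theI') (use is_pseudoinverse_exists is_pseudoinverse_unique in blast)

lemma pseudoinverse_in_row_space: "pseudoinverse A *v y \<in> row_space A"
  for A :: "real^'n^'m"
proof -
  let ?B = "pseudoinverse A"
  have "?B *v y = transpose (?B ** A) *v (?B *v y)"
    using pseudoinverse[of A] by (simp add: is_pseudoinverse_def matrix_vector_mul_assoc)
  also have "\<dots> = transpose A *v (transpose ?B *v (?B *v y))"
    by (simp add: matrix_transpose_mul flip: matrix_vector_mul_assoc)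
  finally show ?thesis by (metis rangeI)
qed

text \<open>
  The vector given by the pseudoinverse solves the system and differs from \<open>x0\<close> by an element of
  the row space, which is orthogonal to differences of solutions. By Pythagoras it is strictly
  closer to \<open>x0\<close> than any other solution, so \<open>arg_min\<close> has no choice.
\<close>

lemma nearest_solution:
  fixes A :: "real^'n^'m" and x0 :: "real^'n"
  assumes "\<exists>x. A *v x = b"
  defines "xs \<equiv> arg_min (\<lambda>x. (norm (x0 - x))\<^sup>2) (\<lambda>x. A *v x = b)"
  shows nearest_solution_is_arg_min: "is_arg_min (\<lambda>x. (norm (x0 - x))\<^sup>2) (\<lambda>x. A *v x = b) xs"
    and nearest_solution_pseudoinverse: "xs = x0 - pseudoinverse A *v (A *v x0 - b)"
proof -
  let ?f = "\<lambda>x. (norm (x0 - x))\<^sup>2"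
  define p where "p = x0 - pseudoinverse A *v (A *v x0 - b)"
  obtain x where x: "A *v x = b" using assms(1) by blast
  have "A *v (pseudoinverse A *v (A *v (x0 - x))) = A *v (x0 - x)"
    using pseudoinverse[of A]
    by (simp add: is_pseudoinverse_def matrix_vector_mul_assoc matrix_mul_assoc)
  then have p: "A *v p = b"
    by (simp add: p_def matrix_vector_mult_diff_distrib x)
  have pyth: "?f y = ?f p + (norm (p - y))\<^sup>2" if "A *v y = b" for y
  proof -
    have "x0 - p \<in> row_space A"
      using pseudoinverse_in_row_space[of A "A *v x0 - b"] by (simp add: p_def)
    moreover have "A *v (p - y) = 0"
      using that p by (simp add: matrix_vector_mult_diff_distrib)
    ultimately have "(x0 - p) \<bullet> (p - y) = 0"
      by (rule row_space_orthogonal_kernel)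
    then show ?thesis
      using norm_add_Pythagorean[of "x0 - p" "p - y"] by (simp add: orthogonal_def)
  qed
  have "?f p \<le> ?f y" if "A *v y = b" for y
    unfolding pyth[OF that] by simp
  with p have min_p: "is_arg_min ?f (\<lambda>x. A *v x = b) p"
    unfolding is_arg_min_linorder by blast
  then show min_xs: "is_arg_min ?f (\<lambda>x. A *v x = b) xs"
    unfolding xs_def arg_min_def by (rule someI)
  then have "A *v xs = b" "?f xs \<le> ?f p"
    using p by (auto simp: is_arg_min_linorder)
  with pyth[of xs] have "(norm (p - xs))\<^sup>2 \<le> 0" by simp
  then show "xs = x0 - pseudoinverse A *v (A *v x0 - b)"
    by (simp add: p_def)
qed

section \<open>One step of the iteration\<close>

text \<open>
  The iterations in the form of an orbit: the index is a parameter of the step.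
\<close>

definition LS_step :: "real^'n^'m \<Rightarrow> real^'m \<Rightarrow> real \<Rightarrow> 'm \<Rightarrow> (real^'n) \<times> real \<Rightarrow> (real^'n) \<times> real" where
  "LS_step A b \<rho> i = (\<lambda>(x, z).
     let z' = ((row i A \<bullet> x - b $ i) + 1 / \<rho> * z) / (1 / \<rho> + (norm (row i A))\<^sup>2)
     in (x - z' *\<^sub>R row i A, z'))"

definition LF_step :: "real^'n^'m \<Rightarrow> real^'m \<Rightarrow> real \<Rightarrow> 'm \<Rightarrow> (real^'n) \<times> real \<Rightarrow> (real^'n) \<times> real" where
  "LF_step A b \<rho> i = (\<lambda>(x, z).
     let z' = max ((row i A \<bullet> x - b $ i) + 1 / \<rho> * z) 0 / (1 / \<rho> + (norm (row i A))\<^sup>2)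
     in (x - z' *\<^sub>R row i A, z'))"

lemma rak_LS_orbit: "rak_LS A b \<rho> x0 z0 i k = orbit (LS_step A b \<rho>) (x0, z0) i k"
  by (induction k) (simp_all add: LS_step_def Let_def)

lemma rak_LF_orbit: "rak_LF A b \<rho> x0 z0 i k = orbit (LF_step A b \<rho>) (x0, z0) i k"
  by (induction k) (simp_all add: LF_step_def Let_def)

text \<open>
  Here \<open>w\<close> is the new multiplier. Since \<open>w (1 + 1 / \<rho>) = r + z / \<rho>\<close>, the quadratic terms equal
  \<open>w (r + z / \<rho>)\<close>, the left-hand side is \<open>w (z / \<rho> - r)\<close>, and the mixed terms in \<open>r z\<close> cancel.
\<close>

lemma dual_update_balance:
  fixes \<rho> r z :: real
  assumes "\<rho> > 0"
  defines "w \<equiv> (r + 1 / \<rho> * z) / (1 / \<rho> + 1)"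
  shows "- 2 * w * r + w\<^sup>2 + 1 / \<rho> * w\<^sup>2
     = - (\<rho> / (1 + \<rho>)) * r\<^sup>2 + (1 - \<rho> / (1 + \<rho>)) * (1 / \<rho> * z\<^sup>2)"
proof -
  have ne: "1 + \<rho> \<noteq> 0" "\<rho> \<noteq> 0" "1 / \<rho> + 1 \<noteq> 0"
    using assms(1) by (auto simp: add_nonneg_eq_0_iff)
  have \<kappa>: "1 - \<rho> / (1 + \<rho>) = 1 / (1 + \<rho>)"
    using ne by (simp add: field_simps)
  have rz: "r + z / \<rho> = w * (1 / \<rho> + 1)"
    using ne by (simp add: w_def)
  then have w: "w = (\<rho> * r + z) / (1 + \<rho>)"
    using ne by (simp add: field_simps)
  have "w\<^sup>2 + 1 / \<rho> * w\<^sup>2 = w * (r + z / \<rho>)"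
    unfolding rz by (simp add: power2_eq_square algebra_simps)
  then have "- 2 * w * r + w\<^sup>2 + 1 / \<rho> * w\<^sup>2 = w * (z / \<rho> - r)"
    by (simp add: algebra_simps)
  also have "\<dots> = (\<rho> * r + z) * (z / \<rho> - r) / (1 + \<rho>)"
    by (simp add: w)
  also have "(\<rho> * r + z) * (z / \<rho> - r) = z\<^sup>2 / \<rho> - \<rho> * r\<^sup>2"
    using ne by (simp add: field_simps power2_eq_square)
  also have "\<dots> / (1 + \<rho>)
      = - (\<rho> / (1 + \<rho>)) * r\<^sup>2 + (1 - \<rho> / (1 + \<rho>)) * (1 / \<rho> * z\<^sup>2)"
    unfolding \<kappa> by (simp add: diff_divide_distrib mult.commute)
  finally show ?thesis .
qed

text \<open>
  If clipping is inactive, this is the previous identity with \<open>r\<^sup>2\<close> bounded below by the square of its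
  positive part. If clipping is active, then \<open>w = 0\<close> and the right-hand side has to be nonnegative.
  This case includes a positive \<open>r\<close> when the initial multiplier is negative; being clipped then means that
  \<open>\<rho> r\<close> is smaller than the absolute value of \<open>z\<close>.
\<close>

lemma clipped_dual_update_balance:
  fixes \<rho> r z :: real
  assumes "\<rho> > 0"
  defines "w \<equiv> max (r + 1 / \<rho> * z) 0 / (1 / \<rho> + 1)"
  shows "- 2 * w * r + w\<^sup>2 + 1 / \<rho> * w\<^sup>2
     \<le> - (\<rho> / (1 + \<rho>)) * (max r 0)\<^sup>2 + (1 - \<rho> / (1 + \<rho>)) * (1 / \<rho> * z\<^sup>2)"
proof (cases "r + 1 / \<rho> * z \<ge> 0")
  case True
  have "(max r 0)\<^sup>2 \<le> r\<^sup>2" by (simp add: max_def)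
  then have "\<rho> / (1 + \<rho>) * (max r 0)\<^sup>2 \<le> \<rho> / (1 + \<rho>) * r\<^sup>2"
    using assms(1) by (intro mult_left_mono) auto
  with True dual_update_balance[OF assms(1), of r z] show ?thesis
    by (simp add: w_def max_absorb1)
next
  case False
  then have "\<rho> * r < - z" using assms(1) by (simp add: field_simps)
  then have "\<rho> * max r 0 \<le> \<bar>z\<bar>"
    using assms(1) by (auto simp: max_def)
  then have "(\<rho> * max r 0)\<^sup>2 \<le> z\<^sup>2"
    using assms(1) by (metis abs_le_square_iff abs_of_nonneg max.cobounded2 mult_nonneg_nonneg less_imp_le)
  then have "\<rho> * (max r 0)\<^sup>2 \<le> z\<^sup>2 / \<rho>"
    using assms(1) by (simp add: field_simps power2_eq_square)
  then have "0 \<le> (z\<^sup>2 / \<rho> - \<rho> * (max r 0)\<^sup>2) / (1 + \<rho>)"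
    using assms(1) by simp
  also have "\<dots> = - (\<rho> / (1 + \<rho>)) * (max r 0)\<^sup>2 + 1 / (1 + \<rho>) * (1 / \<rho> * z\<^sup>2)"
    by (simp add: diff_divide_distrib mult.commute)
  also have "1 / (1 + \<rho>) = 1 - \<rho> / (1 + \<rho>)"
    using assms(1) by (simp add: field_simps)
  finally show ?thesis using False by (simp add: w_def max_absorb2)
qed

lemma norm_sq_step:
  fixes a e :: "'a::real_inner"
  assumes "(norm a)\<^sup>2 = 1"
  shows "(norm (e - w *\<^sub>R a))\<^sup>2 = (norm e)\<^sup>2 - 2 * w * (a \<bullet> e) + w\<^sup>2"
  using assms
  unfolding power2_norm_eq_inner
  by (simp add: inner_diff_left inner_diff_right inner_commute power2_eq_square)

lemma LS_step_lyapunov: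
  fixes A :: "real^'n^'m"
  assumes "(norm (row i A))\<^sup>2 = 1" "\<rho> > 0" "A *v xs = b"
  shows "lyapunov_LS \<rho> xs (LS_step A b \<rho> i (x, z))
     = (norm (x - xs))\<^sup>2 - \<rho> / (1 + \<rho>) * ((A *v (x - xs)) $ i)\<^sup>2
         + (1 - \<rho> / (1 + \<rho>)) * (1 / \<rho> * \<bar>z\<bar>\<^sup>2)"
proof -
  define r where "r = row i A \<bullet> (x - xs)"
  define w where "w = (r + 1 / \<rho> * z) / (1 / \<rho> + 1)"
  have r: "row i A \<bullet> x - b $ i = r" "(A *v (x - xs)) $ i = r"
    by (simp_all add: r_def inner_diff_right matrix_vector_component_row flip: assms(3))
  have "LS_step A b \<rho> i (x, z) = (x - w *\<^sub>R row i A, w)"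
    unfolding LS_step_def Let_def prod.case assms(1) r(1) w_def ..
  then have "lyapunov_LS \<rho> xs (LS_step A b \<rho> i (x, z))
      = (norm ((x - xs) - w *\<^sub>R row i A))\<^sup>2 + 1 / \<rho> * w\<^sup>2"
    by (simp add: lyapunov_LS_def algebra_simps)
  also have "\<dots> = (norm (x - xs))\<^sup>2 + (- 2 * w * r + w\<^sup>2 + 1 / \<rho> * w\<^sup>2)"
    by (simp add: norm_sq_step[OF assms(1)] r_def)
  also have "\<dots> = (norm (x - xs))\<^sup>2 - \<rho> / (1 + \<rho>) * r\<^sup>2 + (1 - \<rho> / (1 + \<rho>)) * (1 / \<rho> * \<bar>z\<bar>\<^sup>2)"
    using dual_update_balance[OF assms(2), of r z] by (simp add: w_def)
  finally show ?thesis by (simp add: r)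
qed

lemma closed_feasible_region: "closed (feasible_region A b)"
  for A :: "real^'n^'m"
proof -
  have "feasible_region A b = (\<Inter>i. {x. A $ i \<bullet> x \<le> b $ i})"
    by (auto simp: feasible_region_def less_eq_vec_def matrix_vector_mul_component)
  then show ?thesis by (auto intro!: closed_INT closed_halfspace_le)
qed

lemma nearest_feasible_point:
  fixes A :: "real^'n^'m"
  assumes "feasible_region A b \<noteq> {}"
  obtains p where "p \<in> feasible_region A b" "infdist x (feasible_region A b) = norm (x - p)"
  using infdist_attains_inf[OF closed_feasible_region assms] by (metis dist_norm)

lemma infdist_le_norm_diff: "p \<in> S \<Longrightarrow> infdist x S \<le> norm (x - p)"
  for x :: "'a::real_normed_vector"
  using infdist_le[of p S x] by (simp add: dist_norm)

lemma feasible_region_component: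
  "p \<in> feasible_region A b \<Longrightarrow> row i A \<bullet> p \<le> b $ i"
  for A :: "real^'n^'m"
  by (metis feasible_region_def less_eq_vec_def matrix_vector_component_row mem_Collect_eq)

text \<open>
  The projection \<open>p\<close> of the old point bounds the distance of the new one. As \<open>p\<close> is feasible, the
  residual \<open>r\<close> is at most the component of \<open>x - p\<close> along the row, and as the multiplier is nonnegative
  the step makes at least the progress measured by \<open>r\<close>.
\<close>

lemma LF_step_lyapunov:
  fixes A :: "real^'n^'m"
  assumes unit: "(norm (row i A))\<^sup>2 = 1" and \<rho>: "\<rho> > 0" and feas: "feasible_region A b \<noteq> {}"
  shows "lyapunov_LF A b \<rho> (LF_step A b \<rho> i (x, z))
     \<le> (infdist x (feasible_region A b))\<^sup>2 - \<rho> / (1 + \<rho>) * (pos_part (A *v x - b) $ i)\<^sup>2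
         + (1 - \<rho> / (1 + \<rho>)) * (1 / \<rho> * \<bar>z\<bar>\<^sup>2)"
proof -
  obtain p where p: "p \<in> feasible_region A b" "infdist x (feasible_region A b) = norm (x - p)"
    using nearest_feasible_point[OF feas] by blast
  define r where "r = row i A \<bullet> x - b $ i"
  define w where "w = max (r + 1 / \<rho> * z) 0 / (1 / \<rho> + 1)"
  have "w \<ge> 0" using \<rho> by (simp add: w_def)
  have pos: "pos_part (A *v x - b) $ i = max r 0"
    by (simp add: pos_part_def r_def matrix_vector_component_row)
  have "r \<le> row i A \<bullet> (x - p)"
    using feasible_region_component[OF p(1), of i] by (simp add: r_def inner_diff_right)
  then have wr: "w * r \<le> w * (row i A \<bullet> (x - p))"
    using \<open>w \<ge> 0\<close> by (rule mult_left_mono)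
  have "infdist (x - w *\<^sub>R row i A) (feasible_region A b) \<le> norm ((x - p) - w *\<^sub>R row i A)"
    using infdist_le_norm_diff[OF p(1), of "x - w *\<^sub>R row i A"] by (simp add: algebra_simps)
  then have "(infdist (x - w *\<^sub>R row i A) (feasible_region A b))\<^sup>2 \<le> (norm ((x - p) - w *\<^sub>R row i A))\<^sup>2"
    by (intro power_mono infdist_nonneg)
  also have "\<dots> \<le> (norm (x - p))\<^sup>2 - 2 * w * r + w\<^sup>2"
    using wr by (simp add: norm_sq_step[OF unit])
  finally have "lyapunov_LF A b \<rho> (LF_step A b \<rho> i (x, z))
      \<le> (norm (x - p))\<^sup>2 + (- 2 * w * r + w\<^sup>2 + 1 / \<rho> * w\<^sup>2)"
    by (simp add: lyapunov_LF_def LF_step_def Let_def unit r_def w_def)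
  also have "\<dots> \<le> (norm (x - p))\<^sup>2 - \<rho> / (1 + \<rho>) * (max r 0)\<^sup>2
      + (1 - \<rho> / (1 + \<rho>)) * (1 / \<rho> * \<bar>z\<bar>\<^sup>2)"
    using clipped_dual_update_balance[OF \<rho>, of r z] by (simp add: w_def)
  finally show ?thesis by (simp add: p(2) pos)
qed

text \<open>
  The residual is itself controlled by the distance: its positive part is at most \<open>A *v (x - p)\<close>
  in absolute value, with \<open>p\<close> the projection of \<open>x\<close>. Combined with the Hoffman bound at an
  infeasible point this forces \<open>m L\<^sup>2 \<ge> 1\<close>.
\<close>

lemma hoffman_card_ge_1:
  fixes A :: "real^'n^'m"
  assumes unit: "\<forall>i. (norm (row i A))\<^sup>2 = 1" and feas: "feasible_region A b \<noteq> {}"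
    and L: "hoffman_constant A b L"
  shows "1 \<le> real CARD('m) * L\<^sup>2"
proof -
  obtain y where y: "y \<in> feasible_region A b" using feas by blast
  define i where "i = (undefined :: 'm)"
  \<comment> \<open>Walking from \<open>y\<close> along a row until its constraint is exceeded by exactly one.\<close>
  define x where "x = y + (b $ i - row i A \<bullet> y + 1) *\<^sub>R row i A"
  have "row i A \<bullet> row i A = 1" using unit by (simp add: power2_norm_eq_inner)
  then have "row i A \<bullet> x = b $ i + 1"
    by (simp add: x_def inner_add_right)
  then have "x \<notin> feasible_region A b"
    using feasible_region_component[of x A b i] by auto
  moreover obtain p where p: "p \<in> feasible_region A b" "infdist x (feasible_region A b) = norm (x - p)"
    using nearest_feasible_point[OF feas] by blast
  ultimately have pos: "(norm (x - p))\<^sup>2 > 0" by auto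
  have "(pos_part (A *v x - b) $ j)\<^sup>2 \<le> ((A *v (x - p)) $ j)\<^sup>2" for j
  proof -
    have "pos_part (A *v x - b) $ j \<le> \<bar>(A *v (x - p)) $ j\<bar>"
      using feasible_region_component[OF p(1), of j]
      by (simp add: pos_part_def matrix_vector_component_row inner_diff_right)
    moreover have "0 \<le> pos_part (A *v x - b) $ j" by (simp add: pos_part_def)
    ultimately show ?thesis by (simp add: abs_le_square_iff[symmetric])
  qed
  then have "(norm (pos_part (A *v x - b)))\<^sup>2 \<le> (norm (A *v (x - p)))\<^sup>2"
    unfolding norm_sq_sum[where 'm = 'm] by (intro sum_mono)
  also have "\<dots> \<le> real CARD('m) * (norm (x - p))\<^sup>2"
    by (rule norm_matrix_vector_le_unit_rows[OF unit])
  finally have "L\<^sup>2 * (norm (pos_part (A *v x - b)))\<^sup>2 \<le> L\<^sup>2 * (real CARD('m) * (norm (x - p))\<^sup>2)"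
    by (intro mult_left_mono) auto
  moreover have "(norm (x - p))\<^sup>2 \<le> L\<^sup>2 * (norm (pos_part (A *v x - b)))\<^sup>2"
    using L p(2) unfolding hoffman_constant_def by metis
  ultimately have "1 * (norm (x - p))\<^sup>2 \<le> (real CARD('m) * L\<^sup>2) * (norm (x - p))\<^sup>2"
    by (simp add: mult_ac)
  then show ?thesis using pos by (rule mult_right_le_imp_le)
qed

text \<open>
  The common end of both cases: \<open>g\<close> is the residual or its positive part, and the second hypothesis is the
  error bound.
\<close>

lemma average_contraction:
  fixes g :: "real^'m"
  assumes V: "\<And>i. V i \<le> D - \<kappa> * (g $ i)\<^sup>2 + (1 - \<kappa>) * Z"
    and g: "q * D \<le> (norm g)\<^sup>2 / real CARD('m)"
    and "q \<le> 1" "0 \<le> \<kappa>" "0 \<le> Z"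
  shows "(\<Sum>i\<in>UNIV. V i) / real CARD('m) \<le> (1 - \<kappa> * q) * (D + Z)"
proof -
  let ?m = "real CARD('m)"
  have "(\<Sum>i\<in>UNIV. V i) \<le> (\<Sum>i\<in>UNIV. D - \<kappa> * (g $ i)\<^sup>2 + (1 - \<kappa>) * Z)"
    by (intro sum_mono V)
  also have "\<dots> = ?m * (D + (1 - \<kappa>) * Z) - \<kappa> * (norm g)\<^sup>2"
    by (simp add: sum.distrib sum_subtractf norm_sq_sum sum_distrib_left algebra_simps)
  finally have "(\<Sum>i\<in>UNIV. V i) / ?m \<le> D + (1 - \<kappa>) * Z - \<kappa> * ((norm g)\<^sup>2 / ?m)"
    by (simp add: field_simps)
  also have "\<dots> \<le> D + (1 - \<kappa>) * Z - \<kappa> * (q * D)"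
    using mult_left_mono[OF g \<open>0 \<le> \<kappa>\<close>] by simp
  also have "\<dots> \<le> (1 - \<kappa> * q) * (D + Z)"
    using mult_left_mono[of q 1 "\<kappa> * Z"] assms(3-5) by (simp add: algebra_simps)
  finally show ?thesis .
qed

lemma LS_average_contraction:
  fixes A :: "real^'n^'m"
  assumes unit: "\<forall>i. (norm (row i A))\<^sup>2 = 1" and \<rho>: "\<rho> > 0" and xs: "A *v xs = b"
    and q: "q \<le> 1" "q * (norm (fst s - xs))\<^sup>2 \<le> (norm (A *v (fst s - xs)))\<^sup>2 / real CARD('m)"
  shows "(\<Sum>i\<in>UNIV. lyapunov_LS \<rho> xs (LS_step A b \<rho> i s)) / real CARD('m)
     \<le> (1 - \<rho> / (1 + \<rho>) * q) * lyapunov_LS \<rho> xs s"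
proof -
  obtain x z where s: "s = (x, z)" by fastforce
  have "(\<Sum>i\<in>UNIV. lyapunov_LS \<rho> xs (LS_step A b \<rho> i s)) / real CARD('m)
     \<le> (1 - \<rho> / (1 + \<rho>) * q) * ((norm (x - xs))\<^sup>2 + 1 / \<rho> * \<bar>z\<bar>\<^sup>2)"
    by (rule average_contraction[where g = "A *v (x - xs)"])
       (use q \<rho> in \<open>simp_all add: s LS_step_lyapunov[OF unit[rule_format] \<rho> xs]\<close>)
  then show ?thesis by (simp add: lyapunov_LS_def s)
qed

lemma LF_average_contraction:
  fixes A :: "real^'n^'m"
  assumes unit: "\<forall>i. (norm (row i A))\<^sup>2 = 1" and \<rho>: "\<rho> > 0" and feas: "feasible_region A b \<noteq> {}"
    and L: "hoffman_constant A b L"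
  shows "(\<Sum>i\<in>UNIV. lyapunov_LF A b \<rho> (LF_step A b \<rho> i s)) / real CARD('m)
     \<le> (1 - \<rho> / (1 + \<rho>) * (1 / (real CARD('m) * L\<^sup>2))) * lyapunov_LF A b \<rho> s"
proof -
  obtain x z where s: "s = (x, z)" by fastforce
  have "L > 0" and "(infdist x (feasible_region A b))\<^sup>2 \<le> L\<^sup>2 * (norm (pos_part (A *v x - b)))\<^sup>2"
    using L by (simp_all add: hoffman_constant_def)
  then have g: "1 / (real CARD('m) * L\<^sup>2) * (infdist x (feasible_region A b))\<^sup>2
      \<le> (norm (pos_part (A *v x - b)))\<^sup>2 / real CARD('m)"
    by (simp add: field_simps)
  have q: "1 / (real CARD('m) * L\<^sup>2) \<le> 1"
    using hoffman_card_ge_1[OF unit feas L] by simp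
  have "(\<Sum>i\<in>UNIV. lyapunov_LF A b \<rho> (LF_step A b \<rho> i s)) / real CARD('m)
     \<le> (1 - \<rho> / (1 + \<rho>) * (1 / (real CARD('m) * L\<^sup>2)))
         * ((infdist x (feasible_region A b))\<^sup>2 + 1 / \<rho> * \<bar>z\<bar>\<^sup>2)"
    unfolding s
    by (rule average_contraction[OF LF_step_lyapunov[OF unit[rule_format] \<rho> feas] g q])
       (use \<rho> in simp_all)
  then show ?thesis by (simp add: lyapunov_LF_def s)
qed

lemma contraction_factor_nonneg:
  fixes \<rho> q :: real
  assumes "\<rho> > 0" "q \<le> 1"
  shows "0 \<le> 1 - \<rho> / (1 + \<rho>) * q"
proof -
  have "\<rho> / (1 + \<rho>) * q \<le> \<rho> / (1 + \<rho>) * 1"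
    using assms by (intro mult_left_mono) auto
  also have "\<dots> \<le> 1" using assms by simp
  finally show ?thesis by simp
qed

lemma contraction_factor_less_1:
  fixes \<rho> q :: real
  assumes "\<rho> > 0" "q > 0"
  shows "1 - \<rho> / (1 + \<rho>) * q < 1"
  using assms by simp

lemma LS_step_row_space:
  fixes A :: "real^'n^'m"
  assumes "fst s - xs \<in> row_space A"
  shows "fst (LS_step A b \<rho> i s) - xs \<in> row_space A"
proof -
  obtain x z where s: "s = (x, z)" by fastforce
  have "fst (LS_step A b \<rho> i s) - xs = (x - xs) - snd (LS_step A b \<rho> i s) *\<^sub>R row i A"
    unfolding s by (simp add: LS_step_def Let_def algebra_simps)
  also have "\<dots> \<in> row_space A"
    using assms unfolding s fst_conv
    by (rule subspace_diff[OF subspace_row_space _ subspace_scale[OF subspace_row_space row_in_row_space]])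
  finally show ?thesis .
qed

text \<open>
  For unit rows the squared Frobenius norm is the number of rows, so the row-norm weights are uniform.
\<close>

lemma uniform_indices_sampling:
  fixes A :: "real^'n^'m"
  assumes unit: "\<forall>i. (norm (row i A))\<^sup>2 = 1" and "rak_sampling A M I"
  shows "uniform_indices M I"
proof -
  have "(norm A)\<^sup>2 = (\<Sum>i\<in>UNIV. (norm (A $ i))\<^sup>2)"
    by (simp add: norm_vec_def L2_set_def sum_nonneg)
  also have "\<dots> = (\<Sum>i\<in>UNIV. (norm (row i A))\<^sup>2)"
    by (simp add: row_def)
  finally have "(norm A)\<^sup>2 = real CARD('m)" by (simp add: unit)
  then show ?thesis
    using assms unfolding rak_sampling_def uniform_indices_def uniform_indices_axioms_def by auto
qed

section \<open>Convergence of the iteration\<close>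

theorem theorem3:
  fixes A :: "real^'n^'m" and b :: "real^'m" and \<rho> :: real
    and x0 :: "real^'n" and z0 :: real
    and M :: "'w measure" and I :: "nat \<Rightarrow> 'w \<Rightarrow> 'm"
  assumes unit_rows: "\<forall>i. (norm (row i A))\<^sup>2 = 1"
    and rho_pos: "\<rho> > 0"
    and sampling: "rak_sampling A M I"
  defines "XLS \<equiv> \<lambda>k \<omega>. rak_LS A b \<rho> x0 z0 (\<lambda>j. I j \<omega>) k"
    and "XLF \<equiv> \<lambda>k \<omega>. rak_LF A b \<rho> x0 z0 (\<lambda>j. I j \<omega>) k"
  shows
    "((\<exists>x. A *v x = b) \<longrightarrow>
       (let xs = arg_min (\<lambda>x. (norm (x0 - x))\<^sup>2) (\<lambda>x. A *v x = b)
        in is_arg_min (\<lambda>x. (norm (x0 - x))\<^sup>2) (\<lambda>x. A *v x = b) xs \<and>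
           xs = x0 - pseudoinverse A *v (A *v x0 - b) \<and>
           (\<lambda>k. \<integral>\<omega>. (norm (fst (XLS k \<omega>) - xs))\<^sup>2 \<partial>M) \<longlonglongrightarrow> 0 \<and>
           (\<forall>k. (\<integral>\<omega>. lyapunov_LS \<rho> xs (XLS (k + 1) \<omega>) \<partial>M)
              \<le> (1 - \<rho> / (1 + \<rho>) * (lambda_min (transpose A ** A) / real CARD('m))) ^ (k + 1)
                * (\<integral>\<omega>. lyapunov_LS \<rho> xs (XLS 0 \<omega>) \<partial>M))))
     \<and>
     (feasible_region A b \<noteq> {} \<longrightarrow>
       (\<forall>L. hoffman_constant A b L \<longrightarrow>
           (\<lambda>k. \<integral>\<omega>. (infdist (fst (XLF k \<omega>)) (feasible_region A b))\<^sup>2 \<partial>M) \<longlonglongrightarrow> 0 \<and>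
           (\<forall>k. (\<integral>\<omega>. lyapunov_LF A b \<rho> (XLF (k + 1) \<omega>) \<partial>M)
              \<le> (1 - \<rho> / (1 + \<rho>) * (1 / (real CARD('m) * L\<^sup>2))) ^ (k + 1)
                * (\<integral>\<omega>. lyapunov_LF A b \<rho> (XLF 0 \<omega>) \<partial>M))))"
proof -
  interpret uniform_indices M I
    by (rule uniform_indices_sampling[OF unit_rows sampling])
  let ?m = "real CARD('m)"
  have LS: "(\<integral>\<omega>. f (XLS k \<omega>) \<partial>M) = expect_orbit (LS_step A b \<rho>) (x0, z0) k f" for k f
    by (simp add: XLS_def rak_LS_orbit expect_orbit_def)
  have LF: "(\<integral>\<omega>. f (XLF k \<omega>) \<partial>M) = expect_orbit (LF_step A b \<rho>) (x0, z0) k f" for k f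
    by (simp add: XLF_def rak_LF_orbit expect_orbit_def)
  show ?thesis
  proof (intro conjI impI allI)
    assume consistent: "\<exists>x. A *v x = b"
    define xs where "xs = arg_min (\<lambda>x. (norm (x0 - x))\<^sup>2) (\<lambda>x. A *v x = b)"
    have xs_min: "is_arg_min (\<lambda>x. (norm (x0 - x))\<^sup>2) (\<lambda>x. A *v x = b) xs"
      and xs_pinv: "xs = x0 - pseudoinverse A *v (A *v x0 - b)"
      unfolding xs_def
      by (rule nearest_solution_is_arg_min[OF consistent], rule nearest_solution_pseudoinverse[OF consistent])
    have xs: "A *v xs = b" using xs_min by (simp add: is_arg_min_def)
    have lim: "(\<lambda>k. \<integral>\<omega>. (norm (fst (XLS k \<omega>) - xs))\<^sup>2 \<partial>M) \<longlonglongrightarrow> 0"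
    proof -
      \<comment> \<open>The constant on the row space is positive also when the smallest eigenvalue vanishes.\<close>
      obtain c where c: "c > 0" "\<And>x. x \<in> row_space A \<Longrightarrow> c * (norm x)\<^sup>2 \<le> (norm (A *v x))\<^sup>2"
        using row_space_bounded_below[of A] by blast
      define q where "q = min 1 (c / ?m)"
      have q: "q \<le> 1" "q > 0" using c(1) by (simp_all add: q_def)
      have qx: "q * (norm x)\<^sup>2 \<le> (norm (A *v x))\<^sup>2 / ?m" if "x \<in> row_space A" for x
      proof -
        have "q * (norm x)\<^sup>2 \<le> c / ?m * (norm x)\<^sup>2"
          by (intro mult_right_mono) (simp_all add: q_def)
        also have "\<dots> \<le> (norm (A *v x))\<^sup>2 / ?m"
          using c(2)[OF that] by (simp add: divide_right_mono)
        finally show ?thesis .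
      qed
      have "(\<lambda>k. expect_orbit (LS_step A b \<rho>) (x0, z0) k (\<lambda>s. (norm (fst s - xs))\<^sup>2)) \<longlonglongrightarrow> 0"
      proof (rule expect_orbit_tendsto_0[where S = "{s. fst s - xs \<in> row_space A}"
            and V = "lyapunov_LS \<rho> xs"])
        show "(x0, z0) \<in> {s. fst s - xs \<in> row_space A}"
          by (simp add: xs_pinv pseudoinverse_in_row_space)
        show "LS_step A b \<rho> i s \<in> {s. fst s - xs \<in> row_space A}"
          if "s \<in> {s. fst s - xs \<in> row_space A}" for i s
          using LS_step_row_space that by blast
        show "(\<Sum>i\<in>UNIV. lyapunov_LS \<rho> xs (LS_step A b \<rho> i s)) / ?m
            \<le> (1 - \<rho> / (1 + \<rho>) * q) * lyapunov_LS \<rho> xs s"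
          if "s \<in> {s. fst s - xs \<in> row_space A}" for s
          using that by (intro LS_average_contraction[OF unit_rows rho_pos xs q(1)] qx) simp
        show "0 \<le> 1 - \<rho> / (1 + \<rho>) * q" "1 - \<rho> / (1 + \<rho>) * q < 1"
          using contraction_factor_nonneg contraction_factor_less_1 rho_pos q by blast+
      qed (use rho_pos in \<open>auto simp: lyapunov_LS_def\<close>)
      then show ?thesis using LS[of "\<lambda>s. (norm (fst s - xs))\<^sup>2"] by simp
    qed
    have rate: "(\<integral>\<omega>. lyapunov_LS \<rho> xs (XLS (k + 1) \<omega>) \<partial>M)
              \<le> (1 - \<rho> / (1 + \<rho>) * (lambda_min (transpose A ** A) / ?m)) ^ (k + 1)
                * (\<integral>\<omega>. lyapunov_LS \<rho> xs (XLS 0 \<omega>) \<partial>M)" for k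
    proof -
      let ?q = "lambda_min (transpose A ** A) / ?m"
      have q: "?q \<le> 1" using lambda_min_gram_le_card[OF unit_rows] by simp
      have qx: "?q * (norm x)\<^sup>2 \<le> (norm (A *v x))\<^sup>2 / ?m" for x
        using lambda_min_gram_le[of A x] by (simp add: divide_right_mono)
      show ?thesis
        unfolding LS[of "lyapunov_LS \<rho> xs"] expect_orbit_0
      proof (rule expect_orbit_decay[where S = UNIV])
        show "(\<Sum>i\<in>UNIV. lyapunov_LS \<rho> xs (LS_step A b \<rho> i s)) / ?m
            \<le> (1 - \<rho> / (1 + \<rho>) * ?q) * lyapunov_LS \<rho> xs s" for s
          by (rule LS_average_contraction[OF unit_rows rho_pos xs q qx])
        show "0 \<le> 1 - \<rho> / (1 + \<rho>) * ?q"
          by (rule contraction_factor_nonneg[OF rho_pos q])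
      qed auto
    qed
    show "let xs = arg_min (\<lambda>x. (norm (x0 - x))\<^sup>2) (\<lambda>x. A *v x = b)
        in is_arg_min (\<lambda>x. (norm (x0 - x))\<^sup>2) (\<lambda>x. A *v x = b) xs \<and>
           xs = x0 - pseudoinverse A *v (A *v x0 - b) \<and>
           (\<lambda>k. \<integral>\<omega>. (norm (fst (XLS k \<omega>) - xs))\<^sup>2 \<partial>M) \<longlonglongrightarrow> 0 \<and>
           (\<forall>k. (\<integral>\<omega>. lyapunov_LS \<rho> xs (XLS (k + 1) \<omega>) \<partial>M)
              \<le> (1 - \<rho> / (1 + \<rho>) * (lambda_min (transpose A ** A) / ?m)) ^ (k + 1)
                * (\<integral>\<omega>. lyapunov_LS \<rho> xs (XLS 0 \<omega>) \<partial>M))"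
      unfolding Let_def xs_def[symmetric] using xs_min xs_pinv lim rate by blast
  next
    fix L assume feas: "feasible_region A b \<noteq> {}" and L: "hoffman_constant A b L"
    let ?q = "1 / (?m * L\<^sup>2)"
    have "L > 0" using L by (simp add: hoffman_constant_def)
    then have q: "?q > 0" "?q \<le> 1" using hoffman_card_ge_1[OF unit_rows feas L] by simp_all
    note contraction = LF_average_contraction[OF unit_rows rho_pos feas L]
    show "(\<lambda>k. \<integral>\<omega>. (infdist (fst (XLF k \<omega>)) (feasible_region A b))\<^sup>2 \<partial>M) \<longlonglongrightarrow> 0"
      unfolding LF[of "\<lambda>s. (infdist (fst s) (feasible_region A b))\<^sup>2"]
    proof (rule expect_orbit_tendsto_0[where S = UNIV and V = "lyapunov_LF A b \<rho>"
          and \<theta> = "1 - \<rho> / (1 + \<rho>) * ?q"])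
      show "(\<Sum>i\<in>UNIV. lyapunov_LF A b \<rho> (LF_step A b \<rho> i s)) / ?m
          \<le> (1 - \<rho> / (1 + \<rho>) * ?q) * lyapunov_LF A b \<rho> s" for s
        by (rule contraction)
      show "0 \<le> 1 - \<rho> / (1 + \<rho>) * ?q" "1 - \<rho> / (1 + \<rho>) * ?q < 1"
        using contraction_factor_nonneg contraction_factor_less_1 rho_pos q by blast+
    qed (use rho_pos in \<open>auto simp: lyapunov_LF_def\<close>)
    show "(\<integral>\<omega>. lyapunov_LF A b \<rho> (XLF (k + 1) \<omega>) \<partial>M)
              \<le> (1 - \<rho> / (1 + \<rho>) * ?q) ^ (k + 1) * (\<integral>\<omega>. lyapunov_LF A b \<rho> (XLF 0 \<omega>) \<partial>M)" for k
      unfolding LF[of "lyapunov_LF A b \<rho>"] expect_orbit_0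
    proof (rule expect_orbit_decay[where S = UNIV])
      show "(\<Sum>i\<in>UNIV. lyapunov_LF A b \<rho> (LF_step A b \<rho> i s)) / ?m
          \<le> (1 - \<rho> / (1 + \<rho>) * ?q) * lyapunov_LF A b \<rho> s" for s
        by (rule contraction)
      show "0 \<le> 1 - \<rho> / (1 + \<rho>) * ?q"
        by (rule contraction_factor_nonneg[OF rho_pos q(2)])
    qed auto
  qed
qed

end
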